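(* For every $\alpha$-minimal graph $G$, $|V(G)|\le 2\alpha(G)-1$.
   Context: All graphs are simple, finite and have at least one vertex. $\alpha(G)$ denotes the independence number of $G$ (with value $0$ for the graph with no vertices). For a vertex $v$, $G-v$ is the subgraph of $G$ induced by $V(G)\setminus\{v\}$. A connected graph $G$ is called $\alpha$-minimal if for every $v\in V(G)$, either $v$ is a cut-vertex of $G$ or $\alpha(G-v)<\alpha(G)$. *)

theory Defs
  imports "Graph_Theory.Graph_Theory"
begin

text \<open>
  A finite simple graph is a \<open>graph\<close> in the sense of \<open>Graph_Theory\<close>: a finite symmetric
  digraph without loops and without parallel arcs, an undirected edge being the pair of
  its two orientations. The locale admits the graph without vertices, while
  \<^const>\<open>connected\<close> excludes it.
\<close>

definition delete_vertex :: "('a, 'b) pre_digraph \<Rightarrow> 'a \<Rightarrow> ('a, 'b) pre_digraph" where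
  "delete_vertex G v = G \<restriction> (verts G - {v})"

definition independent_set :: "('a, 'b) pre_digraph \<Rightarrow> 'a set \<Rightarrow> bool" where
  "independent_set G S \<longleftrightarrow> S \<subseteq> verts G \<and> (\<forall>u\<in>S. \<forall>v\<in>S. \<not> u \<rightarrow>\<^bsub>G\<^esub> v)"

text \<open>
  For finite \<open>G\<close> the maximum ranges over a finite set, which contains
  0 because of the empty set; so the value is 0 if \<open>G\<close> has no vertices.
\<close>
definition independence_number :: "('a, 'b) pre_digraph \<Rightarrow> nat" where
  "independence_number G = Max {card S | S. independent_set G S}"

text \<open>
  A cut-vertex is a vertex whose deletion increases the number of connected components.
  The connected components of a symmetric digraph are its strongly connected components;
  the graph without vertices has none.
\<close>
definition cut_vertex :: "('a, 'b) pre_digraph \<Rightarrow> 'a \<Rightarrow> bool" where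
  "cut_vertex G v \<longleftrightarrow>
     v \<in> verts G \<and> card (pre_digraph.sccs G) < card (pre_digraph.sccs (delete_vertex G v))"

definition alpha_minimal :: "('a, 'b) pre_digraph \<Rightarrow> bool" where
  "alpha_minimal G \<longleftrightarrow> connected G \<and>
     (\<forall>v\<in>verts G. cut_vertex G v \<or>
        independence_number (delete_vertex G v) < independence_number G)"

end

theory Submission
  imports Defs
begin

text \<open>
  The bound is generalised so that it can be proved by induction on the order: if \<open>W\<close> is a nonempty
  set of exempt vertices and every other vertex of a connected graph is a cut-vertex or lowers
  \<open>\<alpha>\<close> when deleted, then \<open>n + 2 \<le> 2\<alpha> + |W|\<close>. Fix \<open>w \<in> W\<close>. An exempt vertex other than \<open>w\<close> whose
  deletion keeps both the connectedness and \<open>\<alpha>\<close> is deleted; if there is none, we may take \<open>W = {w}\<close>.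
  If only \<open>w\<close> can be a cut-vertex, all other vertices lie in a common maximum independent set.
  Otherwise choose a cut-vertex \<open>c \<noteq> w\<close> for which the component \<open>H\<close> of \<open>w\<close> in \<open>G - c\<close> is largest. By
  maximality no vertex outside \<open>H + c\<close> is a cut-vertex, so these vertices lie in all maximum
  independent sets and are leaves attached to \<open>c\<close>. Induction applies to \<open>H\<close>, where at most one
  new exempt vertex arises, namely the only neighbour of \<open>c\<close> in \<open>H\<close>; if there is just one leaf,
  then even this vertex lowers \<open>\<alpha>(H)\<close> when deleted.
\<close>

section \<open>Connectedness of vertex sets\<close>

locale simple_graph =
  fixes E :: "'a \<Rightarrow> 'a \<Rightarrow> bool"
  assumes E_sym: "E x y \<Longrightarrow> E y x"
    and E_irrefl: "\<not> E x x"
begin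

text \<open>Connectedness in cut form, which avoids walks. Working with vertex sets under one fixed
  relation lets the induction pass to subsets without building subgraphs. The empty set counts as
  connected.\<close>

definition conn :: "'a set \<Rightarrow> bool" where
  "conn X \<longleftrightarrow> (\<forall>A\<subseteq>X. A \<noteq> {} \<longrightarrow> A \<noteq> X \<longrightarrow> (\<exists>a\<in>A. \<exists>b\<in>X - A. E a b))"

definition indep :: "'a set \<Rightarrow> bool" where
  "indep S \<longleftrightarrow> (\<forall>u\<in>S. \<forall>v\<in>S. \<not> E u v)"

definition alpha :: "'a set \<Rightarrow> nat" where
  "alpha X = Max {card S | S. S \<subseteq> X \<and> indep S}"

lemma connE:
  assumes "conn X" "A \<subseteq> X" "a \<in> A" "x \<in> X" "x \<notin> A"
  obtains a b where "a \<in> A" "b \<in> X - A" "E a b"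
  using assms unfolding conn_def by blast

lemma conn_singleton [simp]: "conn {x}"
  by (auto simp: conn_def)

lemma conn_insert:
  assumes "conn X" "x \<in> X" "E x y"
  shows "conn (insert y X)"
  unfolding conn_def
proof (intro allI impI)
  fix A assume A: "A \<subseteq> insert y X" "A \<noteq> {}" "A \<noteq> insert y X"
  show "\<exists>a\<in>A. \<exists>b\<in>insert y X - A. E a b"
  proof (cases "A \<inter> X = {} \<or> X \<subseteq> A")
    case True
    with A assms E_sym[OF assms(3)] show ?thesis by (cases "y \<in> A") blast+
  next
    case False
    then obtain z z' where "z \<in> A \<inter> X" "z' \<in> X" "z' \<notin> A \<inter> X" by blast
    from connE[OF assms(1) _ this] obtain a b where "a \<in> A \<inter> X" "b \<in> X - A \<inter> X" "E a b"
      by blast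
    then show ?thesis by blast
  qed
qed

lemma conn_union_pendant:
  assumes "finite L" "conn X" "c \<in> X" "\<And>l. l \<in> L \<Longrightarrow> E l c"
  shows "conn (L \<union> X)"
  using assms(1,4)
proof (induction L rule: finite_induct)
  case (insert l L)
  with assms(3) show ?case using conn_insert[of "L \<union> X" c l] E_sym by simp
qed (use assms(2) in simp)

text \<open>A connected set of greatest size between \<open>K\<close> and \<open>X\<close> cannot
  absorb a further neighbour, so no edge leaves it. It plays the role of the component of
  \<open>X\<close> around \<open>K\<close>.\<close>

lemma conn_maximal_extension:
  assumes "finite X" "K \<subseteq> X" "conn K" "K \<noteq> {}"
  obtains H where "K \<subseteq> H" "H \<subseteq> X" "conn H" "\<And>x y. x \<in> H \<Longrightarrow> y \<in> X - H \<Longrightarrow> \<not> E x y"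
proof -
  let ?P = "\<lambda>H. K \<subseteq> H \<and> H \<subseteq> X \<and> conn H"
  have "?P K" using assms by blast
  moreover have "\<forall>H. ?P H \<longrightarrow> card H < Suc (card X)"
    using assms(1) by (auto simp: less_Suc_eq_le intro: card_mono)
  ultimately obtain H where H: "?P H" and max: "\<And>H'. ?P H' \<Longrightarrow> card H' \<le> card H"
    using ex_has_greatest_nat[of ?P K card "Suc (card X)"] by blast
  have "\<not> E x y" if "x \<in> H" "y \<in> X - H" for x y
  proof
    assume "E x y"
    then have "?P (insert y H)" using H that conn_insert[of H x y] by blast
    moreover have "finite H" using H assms(1) finite_subset by blast
    ultimately show False using max[of "insert y H"] that by simp
  qed
  with H that show thesis by blast
qed

section \<open>Independence number of vertex sets\<close>

lemma indep_subset: "indep S \<Longrightarrow> T \<subseteq> S \<Longrightarrow> indep T"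
  by (auto simp: indep_def)

lemma indep_empty [simp]: "indep {}"
  by (auto simp: indep_def)

lemma indep_insert: "indep (insert x S) \<longleftrightarrow> indep S \<and> (\<forall>y\<in>S. \<not> E x y)"
  using E_sym E_irrefl by (auto simp: indep_def)

lemma finite_indep_cards: "finite X \<Longrightarrow> finite {card S | S. S \<subseteq> X \<and> indep S}"
  by (rule finite_subset[of _ "card ` Pow X"]) auto

lemma card_le_alpha: "finite X \<Longrightarrow> S \<subseteq> X \<Longrightarrow> indep S \<Longrightarrow> card S \<le> alpha X"
  unfolding alpha_def using finite_indep_cards[of X] by (auto intro!: Max_ge)

lemma alpha_attained:
  assumes "finite X"
  obtains S where "S \<subseteq> X" "indep S" "card S = alpha X"
proof -
  have "{card S | S. S \<subseteq> X \<and> indep S} \<noteq> {}" using indep_empty by blast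
  from Max_in[OF finite_indep_cards[OF assms] this] that show thesis
    unfolding alpha_def by auto
qed

lemma alpha_mono:
  assumes "finite Y" "X \<subseteq> Y"
  shows "alpha X \<le> alpha Y"
proof -
  have "finite X" using assms finite_subset by blast
  from alpha_attained[OF this] obtain S where "S \<subseteq> X" "indep S" "card S = alpha X" by blast
  with card_le_alpha[of Y S] assms show ?thesis by auto
qed

lemma alpha_add_isolated:
  assumes "finite Y" "X \<subseteq> Y" "v \<in> Y" "v \<notin> X" "\<And>x. x \<in> X \<Longrightarrow> \<not> E v x"
  shows "alpha X + 1 \<le> alpha Y"
proof -
  have "finite X" using assms finite_subset by blast
  from alpha_attained[OF this] obtain S where S: "S \<subseteq> X" "indep S" "card S = alpha X" by blast
  then have "indep (insert v S)" using assms by (auto simp: indep_insert)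
  moreover have "card (insert v S) = alpha X + 1"
    using S assms(4) \<open>finite X\<close> finite_subset[of S X] by (subst card_insert_disjoint) auto
  ultimately show ?thesis using card_le_alpha[of Y "insert v S"] S assms by auto
qed

lemma critical_in_maximum:
  assumes "finite X" "alpha (X - {v}) < alpha X" "S \<subseteq> X" "indep S" "card S = alpha X"
  shows "v \<in> S"
proof (rule ccontr)
  assume "v \<notin> S"
  then have "card S \<le> alpha (X - {v})"
    using assms by (intro card_le_alpha) auto
  with assms show False by simp
qed

text \<open>By \<open>critical_in_maximum\<close>, any single maximum independent set contains all
  critical vertices at once.\<close>

lemma indep_of_critical:
  assumes "finite X" "L \<subseteq> X" "\<And>v. v \<in> L \<Longrightarrow> alpha (X - {v}) < alpha X"
  shows "indep L" "card L \<le> alpha X"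
proof -
  obtain S where S: "S \<subseteq> X" "indep S" "card S = alpha X" using alpha_attained[OF assms(1)] by blast
  then have "L \<subseteq> S" using critical_in_maximum[OF assms(1)] assms(3) by blast
  then show "indep L" using S indep_subset by blast
  then show "card L \<le> alpha X" using card_le_alpha assms by blast
qed

lemma alpha_pendant_ge:
  assumes "finite L" "finite X" "indep L" "L \<inter> X = {}" "\<And>l x. l \<in> L \<Longrightarrow> x \<in> X \<Longrightarrow> \<not> E l x"
    and "L \<union> X \<subseteq> Y" "finite Y"
  shows "card L + alpha X \<le> alpha Y"
proof -
  obtain S where S: "S \<subseteq> X" "indep S" "card S = alpha X" using alpha_attained[OF assms(2)] by blast
  have "indep (L \<union> S)" using assms(3,5) S E_sym unfolding indep_def by blast
  moreover have "card (L \<union> S) = card L + alpha X"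
    using S assms finite_subset[of S X] by (subst card_Un_disjoint) auto
  ultimately show ?thesis using card_le_alpha[of Y "L \<union> S"] S assms by auto
qed

text \<open>An independent set containing \<open>c\<close> avoids \<open>L\<close>, and the one
  element \<open>c\<close> is paid for by \<open>1 \<le> card L\<close>. Without \<open>c\<close>,
  the set splits into a part in \<open>L\<close> and a part in \<open>X\<close>.\<close>

lemma alpha_pendant_le:
  assumes "finite L" "finite X" "L \<noteq> {}" "\<And>l. l \<in> L \<Longrightarrow> E l c"
  shows "alpha (L \<union> insert c X) \<le> card L + alpha X"
proof -
  obtain S where S: "S \<subseteq> L \<union> insert c X" "indep S" "card S = alpha (L \<union> insert c X)"
    using alpha_attained[of "L \<union> insert c X"] assms by auto
  have SX: "card (S \<inter> X) \<le> alpha X"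
    using S(2) assms(2) by (intro card_le_alpha) (auto intro: indep_subset)
  have fin: "finite (S \<inter> X)" using assms by blast
  show ?thesis
  proof (cases "c \<in> S")
    case True
    then have "S \<subseteq> insert c (S \<inter> X)" using S assms(4) unfolding indep_def by blast
    then have "card S \<le> card (insert c (S \<inter> X))" using fin by (intro card_mono) auto
    also have "\<dots> \<le> 1 + card (S \<inter> X)" using fin by (simp add: card_insert_if)
    also have "1 \<le> card L" using assms by (simp add: Suc_leI card_gt_0_iff)
    finally show ?thesis using S SX by simp
  next
    case False
    then have "S \<subseteq> L \<union> (S \<inter> X)" using S by blast
    then have "card S \<le> card (L \<union> (S \<inter> X))" using fin assms by (intro card_mono) auto
    also have "\<dots> \<le> card L + card (S \<inter> X)" by (rule card_Un_le)
    finally show ?thesis using S SX by simp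
  qed
qed

section \<open>The generalised bound by induction\<close>

lemma exempt_deletion:
  assumes fin: "finite U" and U: "conn U" and v: "v \<in> U" "alpha (U - {v}) = alpha U"
    and u: "u \<in> U - {v}" "\<not> conn (U - {u}) \<or> alpha (U - {u}) < alpha U"
  shows "\<not> conn (U - {v} - {u}) \<or> alpha (U - {v} - {u}) < alpha (U - {v})"
proof (rule ccontr)
  assume "\<not> ?thesis"
  then have c: "conn (U - {v} - {u})" and a: "alpha U \<le> alpha (U - {v} - {u})" using v by auto
  have "alpha (U - {v} - {u}) \<le> alpha (U - {u})" using fin by (intro alpha_mono) auto
  \<comment> \<open>Since \<open>u\<close> does not lower \<alpha>, it must be a cut-vertex of
    \<open>U\<close>. So adding \<open>v\<close> to the connected set \<open>U - {v} - {u}\<close>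
    disconnects it; hence \<open>v\<close> has no neighbour there and can be added to a maximum
    independent set.\<close>
  with a u have nc: "\<not> conn (U - {u})" by linarith
  have "U - {u} = insert v (U - {v} - {u})" using u v by blast
  then have "\<not> E v x" if "x \<in> U - {v} - {u}" for x
    using nc conn_insert[OF c that, of v] E_sym by auto
  then have "alpha (U - {v} - {u}) + 1 \<le> alpha U"
    using v u by (intro alpha_add_isolated[OF fin, of _ v]) auto
  with a show False by simp
qed

text \<open>The vertices other than \<open>w\<close> form an independent set, so there are at most
  \<alpha> of them. As soon as there is one, its deletion leaves \<open>w\<close> and still lowers
  \<alpha>, so \<alpha> \<ge> 2, which gives the remaining 2.\<close>

lemma card_bound_no_cut:
  assumes fin: "finite U" and U: "w \<in> U"
    and crit: "\<And>v. v \<in> U - {w} \<Longrightarrow> alpha (U - {v}) < alpha U"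
  shows "card U + 1 \<le> 2 * alpha U"
proof -
  have le: "card (U - {w}) \<le> alpha U"
    by (rule indep_of_critical(2)[OF fin _ crit]) auto
  have pos: "1 \<le> alpha X" if "finite X" "w \<in> X" for X
    using card_le_alpha[of X "{w}"] that by (simp add: indep_insert)
  have card: "card U = card (U - {w}) + 1" using card_Suc_Diff1[OF fin U] by simp
  show ?thesis
  proof (cases "U - {w} = {}")
    case True
    then have "card U = 1" using card by (metis add_0 card.empty)
    then show ?thesis using pos[OF fin U] by linarith
  next
    case False
    then obtain v where "v \<in> U - {w}" by blast
    with crit[of v] pos[of "U - {v}"] fin U have "2 \<le> alpha U" by auto
    with le card show ?thesis by linarith
  qed
qed

lemma exists_leaf_star:
  assumes fin: "finite U" and U: "conn U" "w \<in> U"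
    and cut: "c0 \<in> U - {w}" "\<not> conn (U - {c0})"
    and crit: "\<And>v. v \<in> U - {w} \<Longrightarrow> \<not> conn (U - {v}) \<or> alpha (U - {v}) < alpha U"
  obtains c H L where "U = L \<union> insert c H" "c \<notin> H" "L \<inter> insert c H = {}" "L \<noteq> {}"
    "w \<in> H" "conn H" "indep L" "\<forall>l\<in>L. E l c" "\<forall>l\<in>L. \<forall>x\<in>H. \<not> E l x"
    "\<forall>l\<in>L. alpha (U - {l}) < alpha U"
proof -
  \<comment> \<open>\<open>H\<close> is the component of \<open>w\<close> in \<open>U - {c}\<close>;
    the strict inclusion makes \<open>c\<close> a cut-vertex.\<close>
  define P where "P = (\<lambda>(c, H). c \<in> U - {w} \<and> w \<in> H \<and> H \<subset> U - {c} \<and> conn H \<and>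
    (\<forall>x\<in>H. \<forall>y\<in>U - {c} - H. \<not> E x y))"
  have ext: "\<exists>H. K \<subseteq> H \<and> P (x, H)"
    if "x \<in> U - {w}" "\<not> conn (U - {x})" "K \<subseteq> U - {x}" "conn K" "w \<in> K" for x K
  proof -
    have "finite (U - {x})" using fin by simp
    from conn_maximal_extension[OF this that(3,4)] that(5) obtain H
      where H: "K \<subseteq> H" "H \<subseteq> U - {x}" "conn H" "\<And>y z. y \<in> H \<Longrightarrow> z \<in> U - {x} - H \<Longrightarrow> \<not> E y z"
      by blast
    moreover have "H \<noteq> U - {x}" using H that by blast
    ultimately show ?thesis using that unfolding P_def by (intro exI[of _ H]) auto
  qed
  obtain H0 where "P (c0, H0)" using ext[OF cut, of "{w}"] cut U by auto
  moreover have "\<forall>p. P p \<longrightarrow> card (snd p) < Suc (card U)"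
    using fin by (auto simp: P_def less_Suc_eq_le intro!: card_mono)
  ultimately obtain p where p: "P p" and max: "\<And>q. P q \<Longrightarrow> card (snd q) \<le> card (snd p)"
    using ex_has_greatest_nat[of P "(c0, H0)" "\<lambda>p. card (snd p)" "Suc (card U)"] by blast
  obtain c H where [simp]: "p = (c, H)" by fastforce
  define L where "L = U - {c} - H"
  have c: "c \<in> U" "c \<noteq> w" and H: "w \<in> H" "H \<subseteq> U - {c}" "conn H" and "L \<noteq> {}"
    and HL: "\<And>x y. x \<in> H \<Longrightarrow> y \<in> L \<Longrightarrow> \<not> E x y"
    using p unfolding P_def L_def by auto
  have finH: "finite H" using H fin finite_subset by blast
  have Lw: "L \<subseteq> U - {w}" using H unfolding L_def by blast
  have "c \<notin> H" using H by blast
  have "H \<subseteq> U" using H by blast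
  \<comment> \<open>Some edge leaves \<open>H\<close>, and it can only end in \<open>c\<close>. So
    \<open>insert c H\<close> is connected, as the maximality argument needs.\<close>
  from connE[OF U(1) this H(1) c(1) \<open>c \<notin> H\<close>] obtain a b
    where ab: "a \<in> H" "b \<in> U - H" "E a b" by metis
  then have "b \<notin> L" using HL by metis
  then have "b = c" using ab unfolding L_def by simp
  then have Hc: "conn (insert c H)" using conn_insert[OF H(3) ab(1)] ab(3) by simp
  have Lcrit: "alpha (U - {l}) < alpha U" if l: "l \<in> L" for l
  proof -
    have "conn (U - {l})"
    proof (rule ccontr)
      assume "\<not> conn (U - {l})"
      \<comment> \<open>Without \<open>l\<close>, the connected set \<open>insert c H\<close>
        survives and contains \<open>w\<close>, so the component of \<open>w\<close> has gained at
        least \<open>c\<close> over \<open>H\<close>, against the maximal choice.\<close>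
      then obtain H' where H': "insert c H \<subseteq> H'" "P (l, H')"
        using ext[of l "insert c H"] l Lw H c Hc unfolding L_def by blast
      then have "finite H'" using fin finite_subset unfolding P_def by blast
      from card_mono[OF this H'(1)] max[OF H'(2)] finH H show False
        using \<open>c \<notin> H\<close> by simp
    qed
    then show ?thesis using crit l Lw by blast
  qed
  have "indep L" using indep_of_critical[OF fin _ Lcrit] Lw by blast
  have Lc: "E l c" if l: "l \<in> L" for l
  proof -
    \<comment> \<open>Connectedness gives \<open>l\<close> a neighbour. It is not in
      \<open>H\<close>, since no edge joins \<open>H\<close> and \<open>L\<close>, and not in the
      independent set \<open>L\<close>; only \<open>c\<close> is left.\<close>
    have "{l} \<subseteq> U" "c \<notin> {l}" using l unfolding L_def by auto
    from connE[OF U(1) this(1) _ c(1) this(2)] obtain b where "E l b" "b \<in> U"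
      by (metis DiffD1 insertI1 singletonD)
    moreover have "b \<notin> H" using HL l \<open>E l b\<close> E_sym by blast
    moreover have "b \<notin> L" using \<open>indep L\<close> l \<open>E l b\<close> unfolding indep_def by blast
    ultimately show ?thesis unfolding L_def by blast
  qed
  show thesis
  proof (rule that[of L c H])
    show "U = L \<union> insert c H" "L \<inter> insert c H = {}" using c H unfolding L_def by auto
    show "\<forall>l\<in>L. \<forall>x\<in>H. \<not> E l x" using HL E_sym by blast
    show "\<forall>l\<in>L. E l c" "\<forall>l\<in>L. alpha (U - {l}) < alpha U" using Lc Lcrit by blast+
  qed fact+
qed

lemma card_bound:
  assumes "finite U" "conn U" "w \<in> W" "W \<subseteq> U"
    and "\<And>v. v \<in> U - W \<Longrightarrow> \<not> conn (U - {v}) \<or> alpha (U - {v}) < alpha U"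
  shows "card U + 2 \<le> 2 * alpha U + card W"
  using assms
proof (induction "card U" arbitrary: U W w rule: less_induct)
  case less
  note fin = less.prems(1) and W = less.prems(3,4)
  have w: "w \<in> U" and finW: "finite W" using W fin finite_subset by blast+
  show ?case
  proof (cases "\<exists>v\<in>W - {w}. conn (U - {v}) \<and> alpha U \<le> alpha (U - {v})")
    case True
    then obtain v where v: "v \<in> W" "v \<noteq> w" "conn (U - {v})" "alpha U \<le> alpha (U - {v})" by blast
    then have eq: "alpha (U - {v}) = alpha U"
      using alpha_mono[OF fin, of "U - {v}"] by auto
    have vU: "v \<in> U" using v W by blast
    have lt: "card (U - {v}) < card U" using fin vU by (rule card_Diff1_less)
    \<comment> \<open>Order and number of exempt vertices both drop by one while \<alpha> stays, so
      the bound transfers back to \<open>U\<close>.\<close>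
    have "card (U - {v}) + 2 \<le> 2 * alpha (U - {v}) + card (W - {v})"
    proof (rule less.hyps[OF lt, where w = w])
      fix u assume u: "u \<in> U - {v} - (W - {v})"
      then show "\<not> conn (U - {v} - {u}) \<or> alpha (U - {v} - {u}) < alpha (U - {v})"
        using less.prems(5)[of u] by (intro exempt_deletion[OF fin less.prems(2) vU eq]) auto
    qed (use fin v W in auto)
    moreover have "card U = card (U - {v}) + 1" "card W = card (W - {v}) + 1"
      using card_Suc_Diff1[OF fin vU] card_Suc_Diff1[OF finW v(1)] by simp_all
    ultimately show ?thesis using eq by linarith
  next
    case False
    then have crit: "\<not> conn (U - {v}) \<or> alpha (U - {v}) < alpha U" if "v \<in> U - {w}" for v
      using less.prems(5)[of v] that by (cases "v \<in> W") (auto simp: not_le)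
    \<comment> \<open>This is the bound for the exempt set \<open>{w}\<close>; it suffices because
      \<open>W\<close> is nonempty.\<close>
    have "card U + 1 \<le> 2 * alpha U"
    proof (cases "\<exists>c\<in>U - {w}. \<not> conn (U - {c})")
      case False
      then show ?thesis using crit by (intro card_bound_no_cut[OF fin w]) blast
    next
      case True
      then obtain c0 where c0: "c0 \<in> U - {w}" "\<not> conn (U - {c0})" by blast
      obtain c H L where U: "U = L \<union> insert c H" "c \<notin> H" "L \<inter> insert c H = {}" "L \<noteq> {}"
        and H: "w \<in> H" "conn H" and L: "indep L" and star: "\<forall>l\<in>L. E l c"
          "\<forall>l\<in>L. \<forall>x\<in>H. \<not> E l x" "\<forall>l\<in>L. alpha (U - {l}) < alpha U"
        by (rule exists_leaf_star[OF fin less.prems(2) w c0 crit])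
      have Lc: "E l c" and HL: "x \<in> H \<Longrightarrow> \<not> E l x" and Lcrit: "alpha (U - {l}) < alpha U"
        if "l \<in> L" for l x using star that by blast+
      have finL: "finite L" and finH: "finite H" using fin U(1) by auto
      have cardU: "card U = card L + 1 + card H"
        using U finL finH by (simp add: card_Un_disjoint)
      have lower: "card L + alpha X \<le> alpha (L \<union> insert c X)" if "X \<subseteq> H" for X
        using that finL finH L HL U finite_subset[OF that finH]
        by (intro alpha_pendant_ge) auto
      have alphaU: "alpha U = card L + alpha H"
        using lower[of H] alpha_pendant_le[OF finL finH U(4) Lc] U(1) by auto
      \<comment> \<open>An edge leaving \<open>H\<close> cannot end in a leaf, so it ends in
        \<open>c\<close>. Its end \<open>u0\<close> in \<open>H\<close> is the only candidate for a
        new exempt vertex.\<close>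
      have "H \<subseteq> U" "c \<in> U" using U(1) by auto
      from connE[OF less.prems(2) this(1) H(1) this(2) U(2)] obtain u0 b
        where u0b: "u0 \<in> H" "b \<in> U - H" "E u0 b" by metis
      then have "b \<notin> L" using HL E_sym by metis
      then have u0: "u0 \<in> H" "E u0 c" using u0b U(1) by auto
      have bad: "2 \<le> card L \<and> u = u0"
        if u: "u \<in> H - {w}" "conn (H - {u})" "alpha H \<le> alpha (H - {u})" for u
      proof -
        have Uu: "U - {u} = L \<union> insert c (H - {u})" using u U by blast
        \<comment> \<open>\<open>L\<close> with a maximum independent set of \<open>H - {u}\<close>
          already has \<alpha>(U) elements, so \<open>crit\<close> makes \<open>u\<close> a
          cut-vertex of \<open>U\<close>.\<close>
        have "alpha U \<le> alpha (U - {u})"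
          using lower[of "H - {u}"] u Uu alphaU by auto
        then have nc: "\<not> conn (U - {u})" using crit[of u] u U by auto
        \<comment> \<open>A neighbour of \<open>c\<close> in \<open>H - {u}\<close> would join
          \<open>H - {u}\<close>, \<open>c\<close> and the leaves into a connected
          \<open>U - {u}\<close>. As \<open>u0\<close> is a neighbour of \<open>c\<close>, this will
          force \<open>u = u0\<close>.\<close>
        have iso: "\<not> E c x" if "x \<in> H - {u}" for x
        proof
          assume "E c x"
          then have "conn (insert c (H - {u}))" using conn_insert[OF u(2) that] E_sym by blast
          from conn_union_pendant[OF finL this _ Lc] show False using nc Uu by simp
        qed
        have "2 \<le> card L"
        proof (rule ccontr)
          assume "\<not> 2 \<le> card L"
          moreover have "card L \<noteq> 0" using finL U by simp
          ultimately have "card L = 1" by linarith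
          then obtain l where l: "L = {l}" by (auto simp: card_1_singleton_iff)
          \<comment> \<open>Here \<open>c\<close> replaces the only leaf \<open>l\<close>: with a
            maximum independent set of \<open>H - {u}\<close> it gives at least 1 + \<alpha>(H) =
            \<alpha>(U) elements avoiding \<open>l\<close>, although \<open>l\<close> is
            critical.\<close>
          have "alpha (H - {u}) + 1 \<le> alpha (U - {l})"
            using iso U l fin by (intro alpha_add_isolated[of _ _ c]) auto
          with Lcrit[of l] l alphaU u show False by simp
        qed
        then show ?thesis using iso[of u0] u0 E_sym by blast
      qed
      \<comment> \<open>The budget is \<open>card W' \<le> card L\<close>: passing from
        \<open>H\<close> to \<open>U\<close> adds \<open>card L + 1\<close> vertices and
        \<open>card L\<close> to \<alpha>, so the induction bound yields
        \<open>card U + 1 \<le> card L + 2 * alpha H + card W'\<close>. A single leaf thus leaves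
        room for \<open>w\<close> only.\<close>
      define W' where "W' = (if 2 \<le> card L then {w, u0} else {w})"
      have "card H < card U" using cardU by simp
      then have "card H + 2 \<le> 2 * alpha H + card W'"
      proof (rule less.hyps[where w = w])
        show "\<not> conn (H - {u}) \<or> alpha (H - {u}) < alpha H" if "u \<in> H - W'" for u
        proof (rule ccontr)
          assume "\<not> ?thesis"
          moreover have "u \<in> H - {w}" using that by (auto simp: W'_def split: if_splits)
          ultimately have "2 \<le> card L \<and> u = u0" using bad[of u] by (simp add: not_less)
          with that show False by (simp add: W'_def)
        qed
      qed (use finH H u0 in \<open>auto simp: W'_def\<close>)
      moreover have "card W' \<le> card L"
      proof (cases "2 \<le> card L")
        case True
        moreover have "card {w, u0} \<le> 2" by (simp add: card_insert_if)
        ultimately show ?thesis by (simp add: W'_def)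
      next
        case False
        moreover have "card L \<noteq> 0" using finL U by simp
        ultimately show ?thesis by (simp add: W'_def)
      qed
      ultimately show ?thesis using cardU alphaU by linarith
    qed
    moreover have "card W \<noteq> 0" using finW W(1) by auto
    ultimately show ?thesis by linarith
  qed
qed

end

section \<open>Transfer to the digraph library\<close>

lemma sccs_strongly_connected:
  assumes "wf_digraph G" "strongly_connected G"
  shows "pre_digraph.sccs G \<subseteq> {G}"
proof
  fix H assume H: "H \<in> pre_digraph.sccs G"
  then have ind: "induced_subgraph H G" unfolding pre_digraph.sccs_def by blast
  \<comment> \<open>Components are maximal among strongly connected induced subgraphs, and
    \<open>G\<close> itself is one of these.\<close>
  have "\<not> verts H \<subset> verts G"
    using H assms wf_digraph.induced_subgraph_refl[OF assms(1)]
    unfolding pre_digraph.sccs_def by blast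
  then have "verts H = verts G"
    using ind unfolding induced_subgraph_def subgraph_def by blast
  moreover from this have "arcs H = arcs G"
    using ind assms(1) unfolding induced_subgraph_def
    by (auto simp: wf_digraph_def)
  moreover have "tail H = tail G" "head H = head G"
    using ind unfolding induced_subgraph_def subgraph_def compatible_def by auto
  ultimately show "H \<in> {G}" by simp
qed

lemma (in graph) simple_graph_dominates: "simple_graph (\<lambda>u v. u \<rightarrow>\<^bsub>G\<^esub> v)"
  using graph_symmetric adj_not_same by unfold_locales auto

text \<open>If the set of vertices reachable from \<open>u\<close> were proper, the cut form of
  connectedness would give an edge leaving it.\<close>

lemma (in graph) strongly_connected_induce:
  assumes "X \<noteq> {}" "simple_graph.conn (\<lambda>u v. u \<rightarrow>\<^bsub>G\<^esub> v) X"
  shows "strongly_connected (G \<restriction> X)"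
proof
  interpret S: simple_graph "\<lambda>u v. u \<rightarrow>\<^bsub>G\<^esub> v" by (rule simple_graph_dominates)
  show "verts (G \<restriction> X) \<noteq> {}" using assms by simp
  fix u v assume uv: "u \<in> verts (G \<restriction> X)" "v \<in> verts (G \<restriction> X)"
  interpret X: wf_digraph "G \<restriction> X" by (rule wellformed_induce_subgraph)
  let ?A = "{x \<in> X. u \<rightarrow>\<^sup>*\<^bsub>G \<restriction> X\<^esub> x}"
  show "u \<rightarrow>\<^sup>*\<^bsub>G \<restriction> X\<^esub> v"
  proof (rule ccontr)
    assume "\<not> ?thesis"
    then obtain a b where ab: "a \<in> ?A" "b \<in> X - ?A" "a \<rightarrow>\<^bsub>G\<^esub> b"
      using S.connE[OF assms(2), of ?A u v] uv by auto
    then have "a \<rightarrow>\<^bsub>G \<restriction> X\<^esub> b" by (auto simp: arcs_ends_conv)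
    then have "u \<rightarrow>\<^sup>*\<^bsub>G \<restriction> X\<^esub> b" using ab X.reachable_adj_trans by blast
    with ab show False by blast
  qed
qed

text \<open>A vertex set that no edge leaves contains everything reachable from it, so in a strongly
  connected graph it cannot be nonempty and proper.\<close>

lemma (in graph) conn_verts:
  assumes "connected G"
  shows "simple_graph.conn (\<lambda>u v. u \<rightarrow>\<^bsub>G\<^esub> v) (verts G)"
proof -
  interpret S: simple_graph "\<lambda>u v. u \<rightarrow>\<^bsub>G\<^esub> v" by (rule simple_graph_dominates)
  have sc: "strongly_connected G"
    using assms sym_arcs by (intro symmetric_connected_imp_strongly_connected)
  show ?thesis
    unfolding S.conn_def
  proof (intro allI impI, rule ccontr)
    fix A assume A: "A \<subseteq> verts G" "A \<noteq> {}" "A \<noteq> verts G"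
      and no: "\<not> (\<exists>a\<in>A. \<exists>b\<in>verts G - A. a \<rightarrow>\<^bsub>G\<^esub> b)"
    obtain a b where ab: "a \<in> A" "b \<in> verts G" "b \<notin> A" using A by blast
    then have "a \<rightarrow>\<^sup>*\<^bsub>G\<^esub> b" using sc A by blast
    then have "b \<in> A"
    proof (induction rule: reachable_induct)
      case (step x y)
      then show ?case using no adj_in_verts by blast
    qed (use ab in simp)
    with ab show False by blast
  qed
qed

lemma (in graph) cut_vertex_not_conn:
  assumes "cut_vertex G v" "connected G"
  shows "\<not> simple_graph.conn (\<lambda>u v. u \<rightarrow>\<^bsub>G\<^esub> v) (verts G - {v})"
proof
  assume c: "simple_graph.conn (\<lambda>u v. u \<rightarrow>\<^bsub>G\<^esub> v) (verts G - {v})"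
  let ?H = "delete_vertex G v"
  have v: "v \<in> verts G" and lt: "card sccs < card (pre_digraph.sccs ?H)"
    using assms unfolding cut_vertex_def by auto
  have wf: "wf_digraph ?H" unfolding delete_vertex_def by (rule wellformed_induce_subgraph)
  have "strongly_connected G"
    using assms(2) sym_arcs by (intro symmetric_connected_imp_strongly_connected)
  then have "G \<in> sccs"
    using induced_subgraph_refl
    by (auto simp: induced_subgraph_def subgraph_def intro!: in_sccsI)
  moreover from \<open>strongly_connected G\<close> have "sccs \<subseteq> {G}"
    by (rule sccs_strongly_connected[OF wf_digraph_axioms])
  ultimately have "sccs = {G}" by blast
  then have "card sccs = 1" by simp
  \<comment> \<open>If \<open>v\<close> is the only vertex, no component is left, because strong
    connectedness requires a vertex; otherwise there is at most the one component \<open>?H\<close>.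
    Either way the count does not rise above 1.\<close>
  moreover have "card (pre_digraph.sccs ?H) \<le> 1"
  proof (cases "verts G - {v} = {}")
    case True
    then have "verts ?H = {}" by (simp add: delete_vertex_def)
    then have "K \<notin> pre_digraph.sccs ?H" for K
      unfolding pre_digraph.sccs_def strongly_connected_def induced_subgraph_def subgraph_def
      by simp
    then have "pre_digraph.sccs ?H = {}" by blast
    then show ?thesis by simp
  next
    case False
    then have "strongly_connected ?H"
      unfolding delete_vertex_def using c by (intro strongly_connected_induce) auto
    from card_mono[OF _ sccs_strongly_connected[OF wf this]] show ?thesis by simp
  qed
  ultimately show False using lt by simp
qed

lemma (in graph) independence_number_induce:
  "independence_number (G \<restriction> X) = simple_graph.alpha (\<lambda>u v. u \<rightarrow>\<^bsub>G\<^esub> v) X"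
proof -
  interpret S: simple_graph "\<lambda>u v. u \<rightarrow>\<^bsub>G\<^esub> v" by (rule simple_graph_dominates)
  have "independent_set (G \<restriction> X) S \<longleftrightarrow> S \<subseteq> X \<and> S.indep S" for S
    unfolding independent_set_def S.indep_def
    by (fastforce simp: arcs_ends_conv)
  then show ?thesis unfolding independence_number_def S.alpha_def by simp
qed

theorem lemma2p1:
  fixes G :: "('a, 'b) pre_digraph"
  assumes "graph G" and "alpha_minimal G"
  shows "int (card (verts G)) \<le> 2 * int (independence_number G) - 1"
proof -
  interpret graph G by fact
  interpret S: simple_graph "\<lambda>u v. u \<rightarrow>\<^bsub>G\<^esub> v" by (rule simple_graph_dominates)
  have con: "connected G" using assms(2) unfolding alpha_minimal_def by blast
  then obtain w where w: "w \<in> verts G"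
    unfolding connected_def strongly_connected_def by auto
  have ind: "independence_number G = S.alpha (verts G)"
    unfolding independence_number_def independent_set_def S.alpha_def S.indep_def by simp
  \<comment> \<open>An arbitrary vertex \<open>w\<close> serves as the single exempt vertex;
    \<open>card {w} = 1\<close> turns the 2 into the 1 of the claim.\<close>
  have "card (verts G) + 2 \<le> 2 * S.alpha (verts G) + card {w}"
  proof (rule S.card_bound[OF _ conn_verts[OF con]])
    fix v assume "v \<in> verts G - {w}"
    then have "cut_vertex G v \<or> independence_number (delete_vertex G v) < independence_number G"
      using assms(2) unfolding alpha_minimal_def by blast
    then show "\<not> S.conn (verts G - {v}) \<or> S.alpha (verts G - {v}) < S.alpha (verts G)"
      using cut_vertex_not_conn[OF _ con] independence_number_induce[of "verts G - {v}"] ind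
      by (auto simp: delete_vertex_def)
  qed (use w in auto)
  then show ?thesis using ind by simp
qed

end
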